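(* Let $0\le\varepsilon\le1$. If $\mathbf{\Theta}$ is a $U\to\ell_2$ $\varepsilon$-subspace embedding for every subspace $$R_r(W_r;\mu):=\mathrm{span}\{\mathbf{R}_U^{-1}\mathbf{r}(\mathbf{x};\mu):\mathbf{x}\in W_r\},\qquad W_r\in\mathcal{L}_r(\mathcal{D}_K),$$ then $$\sqrt{1-\varepsilon}\,\zeta_{r,K}(\mu)\le\zeta^{\mathbf{\Theta}}_{r,K}(\mu)\le\sqrt{1+\varepsilon}\,\zeta_{r,K}(\mu)$$ and $$\sqrt{1-\varepsilon}\,\iota_{r,K}(\mu)\le\iota^{\mathbf{\Theta}}_{r,K}(\mu)\le\sqrt{1+\varepsilon}\,\iota_{r,K}(\mu).$$
   Context: Let $\mathbb{K}=\mathbb{R}$ or $\mathbb{C}$, $U=U'=\mathbb{K}^n$, $\langle\cdot,\cdot\rangle$ and $\|\cdot\|$ the canonical $\ell_2$-inner product and norm. $\mathbf{R}_U\in\mathbb{K}^{n\times n}$ is symmetric (Hermitian if $\mathbb{K}=\mathbb{C}$) positive definite. $U$ is equipped with $\langle\cdot,\cdot\rangle_U=\langle\mathbf{R}_U\cdot,\cdot\rangle$ and $U'$ with $\langle\cdot,\cdot\rangle_{U'}=\langle\cdot,\mathbf{R}_U^{-1}\cdot\rangle$; $\|\cdot\|_U,\|\cdot\|_{U'}$ are the associated norms. For $\mathbf{\Theta}\in\mathbb{K}^{k\times n}$ ($k\le n$), define the semi-inner product $\langle\mathbf{x},\mathbf{y}\rangle^{\mathbf{\Theta}}_U=\langle\mathbf{\Theta}\mathbf{x},\mathbf{\Theta}\mathbf{y}\rangle$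 on $U$ and the semi-norm $\|\mathbf{y}\|^{\mathbf{\Theta}}_{U'}=\|\mathbf{\Theta}\mathbf{R}_U^{-1}\mathbf{y}\|$ on $U'$. $\mathbf{\Theta}$ is a $U\to\ell_2$ $\varepsilon$-subspace embedding for a subspace $V\subset U$ if $|\langle\mathbf{x},\mathbf{y}\rangle_U-\langle\mathbf{x},\mathbf{y}\rangle^{\mathbf{\Theta}}_U|\le\varepsilon\|\mathbf{x}\|_U\|\mathbf{y}\|_U$ for all $\mathbf{x},\mathbf{y}\in V$. For a fixed parameter value $\mu$, $\mathbf{A}(\mu)\in\mathbb{K}^{n\times n}$ (a linear operator $U\to U'$), $\mathbf{b}(\mu)\in U'$, and $\mathbf{u}(\mu)\in U$ satisfies $\mathbf{A}(\mu)\mathbf{u}(\mu)=\mathbf{b}(\mu)$. The residual is $\mathbf{r}(\mathbf{x};\mu)=\mathbf{b}(\mu)-\mathbf{A}(\mu)\mathbf{x}$. $\mathcal{D}_K\subset U$ is a dictionary of $K\ge r\ge1$ vectors and $\mathcal{L}_r(\mathcal{D}_K)$ is the collection of all subspaces spanned by $r$ vectors from $\mathcal{D}_K$. The sets $\mathrm{span}\{\mathbf{u}(\mu)\}+W_r$ are assumed nonzero. Define $$\zeta_{r,K}(\mu)=\min_{W_r\in\mathcal{L}_r(\mathcal{D}_K)}\ \min_{\mathbf{x}\in(\mathrm{span}\{\mathbf{u}(\mu)\}+W_r)\setminus\{\mathbf{0}\}}\frac{\|\mathbf{A}(\mu)\mathbf{x}\|_{U'}}{\|\mathbf{x}\|_U},$$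 $$\iota_{r,K}(\mu)=\max_{W_r\in\mathcal{L}_r(\mathcal{D}_K)}\ \max_{\mathbf{x}\in(\mathrm{span}\{\mathbf{u}(\mu)\}+W_r)\setminus\{\mathbf{0}\}}\frac{\|\mathbf{A}(\mu)\mathbf{x}\|_{U'}}{\|\mathbf{x}\|_U},$$ and $\zeta^{\mathbf{\Theta}}_{r,K}(\mu)$, $\iota^{\mathbf{\Theta}}_{r,K}(\mu)$ by the same formulas with $\|\mathbf{A}(\mu)\mathbf{x}\|_{U'}$ replaced by $\|\mathbf{A}(\mu)\mathbf{x}\|^{\mathbf{\Theta}}_{U'}$ (the denominators $\|\mathbf{x}\|_U$ unchanged). *)

theory Defs
  imports "HOL-Analysis.Analysis" "HOL-Library.Set_Algebras"
begin

text \<open>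
  The scalar field, \<open>\<real>\<close> or \<open>\<complex>\<close>.  Both are instances below, and by the Gelfand-Mazur theorem they are
  the only instances up to isomorphism, the norm then being the usual absolute value.  The last two
  axioms determine \<^term>\<open>sc_cnj\<close> and \<^term>\<open>sc_Re\<close>.
\<close>

class real_or_complex = real_normed_field + euclidean_space +
  fixes sc_cnj :: "'a \<Rightarrow> 'a"
    and sc_Re :: "'a \<Rightarrow> real"
  assumes sc_cnj_add: "sc_cnj (x + y) = sc_cnj x + sc_cnj y"
    and sc_cnj_mult: "sc_cnj (x * y) = sc_cnj x * sc_cnj y"
    and sc_mult_cnj: "x * sc_cnj x = (norm x)\<^sup>2 *\<^sub>R 1"
    and sc_add_cnj: "x + sc_cnj x = (2 * sc_Re x) *\<^sub>R 1"

instantiation real :: real_or_complex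
begin
definition sc_cnj_real :: "real \<Rightarrow> real" where "sc_cnj_real x = x"
definition sc_Re_real :: "real \<Rightarrow> real" where "sc_Re_real x = x"
instance
  by standard (simp_all add: sc_cnj_real_def sc_Re_real_def power2_eq_square)
end

instantiation complex :: real_or_complex
begin
definition sc_cnj_complex :: "complex \<Rightarrow> complex" where "sc_cnj_complex = cnj"
definition sc_Re_complex :: "complex \<Rightarrow> real" where "sc_Re_complex = Re"
instance
  by standard
    (simp_all only: sc_cnj_complex_def sc_Re_complex_def complex_cnj_add complex_cnj_mult
      complex_norm_square[symmetric] complex_add_cnj scaleR_conv_of_real mult_1_right)
end

text \<open>
  On \<^typ>\<open>'a::real_or_complex ^ 'n\<close> the library \<^term>\<open>norm\<close> is the canonical \<open>\<ell>\<^sub>2\<close>-norm,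
  and \<^term>\<open>vec.span\<close> is the span over the field \<^typ>\<open>'a\<close> (whereas \<^term>\<open>span\<close> is the real span).
\<close>

definition ip :: "'a::real_or_complex ^ 'n \<Rightarrow> 'a ^ 'n \<Rightarrow> 'a" where
  "ip x y = (\<Sum>i\<in>UNIV. x $ i * sc_cnj (y $ i))"

definition hermitian_pos_def :: "'a::real_or_complex ^ 'n ^ 'n \<Rightarrow> bool" where
  "hermitian_pos_def R \<longleftrightarrow>
     (\<forall>i j. R $ j $ i = sc_cnj (R $ i $ j)) \<and> (\<forall>x. x \<noteq> 0 \<longrightarrow> 0 < sc_Re (ip (R *v x) x))"

definition ip_U :: "'a::real_or_complex ^ 'n ^ 'n \<Rightarrow> 'a ^ 'n \<Rightarrow> 'a ^ 'n \<Rightarrow> 'a" where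
  "ip_U R x y = ip (R *v x) y"

definition norm_U :: "'a::real_or_complex ^ 'n ^ 'n \<Rightarrow> 'a ^ 'n \<Rightarrow> real" where
  "norm_U R x = sqrt (sc_Re (ip_U R x x))"

definition ip_dual :: "'a::real_or_complex ^ 'n ^ 'n \<Rightarrow> 'a ^ 'n \<Rightarrow> 'a ^ 'n \<Rightarrow> 'a" where
  "ip_dual R x y = ip x (matrix_inv R *v y)"

definition norm_dual :: "'a::real_or_complex ^ 'n ^ 'n \<Rightarrow> 'a ^ 'n \<Rightarrow> real" where
  "norm_dual R y = sqrt (sc_Re (ip_dual R y y))"

definition sketched_ip_U :: "'a::real_or_complex ^ 'n ^ 'k \<Rightarrow> 'a ^ 'n \<Rightarrow> 'a ^ 'n \<Rightarrow> 'a" where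
  "sketched_ip_U \<Theta> x y = ip (\<Theta> *v x) (\<Theta> *v y)"

definition sketched_norm_dual ::
    "'a::real_or_complex ^ 'n ^ 'k \<Rightarrow> 'a ^ 'n ^ 'n \<Rightarrow> 'a ^ 'n \<Rightarrow> real" where
  "sketched_norm_dual \<Theta> R y = norm (\<Theta> *v (matrix_inv R *v y))"

definition subspace_embedding ::
    "'a::real_or_complex ^ 'n ^ 'n \<Rightarrow> 'a ^ 'n ^ 'k \<Rightarrow> real \<Rightarrow> ('a ^ 'n) set \<Rightarrow> bool" where
  "subspace_embedding R \<Theta> \<epsilon> V \<longleftrightarrow>
     (\<forall>x\<in>V. \<forall>y\<in>V. norm (ip_U R x y - sketched_ip_U \<Theta> x y) \<le> \<epsilon> * norm_U R x * norm_U R y)"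

text \<open>The \<open>r\<close> vectors are distinct but need not be linearly independent.\<close>

definition spanned_subspaces :: "nat \<Rightarrow> ('a::real_or_complex ^ 'n) set \<Rightarrow> ('a ^ 'n) set set" where
  "spanned_subspaces r D = {vec.span S | S. S \<subseteq> D \<and> card S = r}"

definition residual ::
    "'a::real_or_complex ^ 'n ^ 'n \<Rightarrow> 'a ^ 'n \<Rightarrow> 'a ^ 'n \<Rightarrow> 'a ^ 'n" where
  "residual A b x = b - A *v x"

definition residual_space ::
    "'a::real_or_complex ^ 'n ^ 'n \<Rightarrow> 'a ^ 'n ^ 'n \<Rightarrow> 'a ^ 'n \<Rightarrow> ('a ^ 'n) set \<Rightarrow> ('a ^ 'n) set" where
  "residual_space R A b W = vec.span {matrix_inv R *v residual A b x | x. x \<in> W}"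

text \<open>
  Minimum and maximum are attained: \<^term>\<open>Least\<close> and \<^term>\<open>Greatest\<close> pick an element
  of the set and are unspecified if there is no extremal one, unlike \<^term>\<open>Inf\<close> and \<^term>\<open>Sup\<close>.
\<close>

definition minimum :: "real set \<Rightarrow> real" where
  "minimum S = (LEAST m. m \<in> S)"

definition maximum :: "real set \<Rightarrow> real" where
  "maximum S = (GREATEST m. m \<in> S)"

text \<open>
  The set of quotients over which the inner extrema are taken; \<open>N\<close> is the norm or sketched
  semi-norm in the numerator.
\<close>

definition quotients ::
    "('a::real_or_complex ^ 'n \<Rightarrow> real) \<Rightarrow> 'a ^ 'n ^ 'n \<Rightarrow> 'a ^ 'n ^ 'n \<Rightarrow> 'a ^ 'n \<Rightarrow> ('a ^ 'n) set \<Rightarrow> real set"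
  where
  "quotients N R A u W = {N (A *v x) / norm_U R x | x. x \<in> (vec.span {u} + W) - {0}}"

definition zeta ::
    "'a::real_or_complex ^ 'n ^ 'n \<Rightarrow> 'a ^ 'n ^ 'n \<Rightarrow> 'a ^ 'n \<Rightarrow> nat \<Rightarrow> ('a ^ 'n) set \<Rightarrow> real" where
  "zeta R A u r D =
     minimum {minimum (quotients (norm_dual R) R A u W) | W. W \<in> spanned_subspaces r D}"

definition iota ::
    "'a::real_or_complex ^ 'n ^ 'n \<Rightarrow> 'a ^ 'n ^ 'n \<Rightarrow> 'a ^ 'n \<Rightarrow> nat \<Rightarrow> ('a ^ 'n) set \<Rightarrow> real" where
  "iota R A u r D =
     maximum {maximum (quotients (norm_dual R) R A u W) | W. W \<in> spanned_subspaces r D}"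

definition sketched_zeta ::
    "'a::real_or_complex ^ 'n ^ 'k \<Rightarrow> 'a ^ 'n ^ 'n \<Rightarrow> 'a ^ 'n ^ 'n \<Rightarrow> 'a ^ 'n \<Rightarrow> nat \<Rightarrow> ('a ^ 'n) set \<Rightarrow> real"
  where
  "sketched_zeta \<Theta> R A u r D =
     minimum {minimum (quotients (sketched_norm_dual \<Theta> R) R A u W) | W. W \<in> spanned_subspaces r D}"

definition sketched_iota ::
    "'a::real_or_complex ^ 'n ^ 'k \<Rightarrow> 'a ^ 'n ^ 'n \<Rightarrow> 'a ^ 'n ^ 'n \<Rightarrow> 'a ^ 'n \<Rightarrow> nat \<Rightarrow> ('a ^ 'n) set \<Rightarrow> real"
  where
  "sketched_iota \<Theta> R A u r D =
     maximum {maximum (quotients (sketched_norm_dual \<Theta> R) R A u W) | W. W \<in> spanned_subspaces r D}"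

end

theory Submission imports Defs begin

text \<open>
  A vector \<open>x = c u + w\<close> with \<open>w \<in> W\<close> satisfies \<open>A x = c r(-w/c)\<close> if \<open>c \<noteq> 0\<close>, and \<open>A x = r(0) - r(w)\<close>
  if \<open>c = 0\<close>.  Hence \<open>R\<inverse> A x\<close> always lies in the residual space of \<open>W\<close>, and the embedding property
  compares the two numerators up to the factors \<open>\<surd>(1 \<plusminus> \<epsilon>)\<close>.  The comparison passes to the extrema
  because these are attained: the quotients are continuous and invariant under real scaling, so
  they take all their values on the compact unit sphere of \<open>span {u} + W\<close>.
\<close>

section \<open>Conjugation and real part, derived from the class axioms\<close>

lemma sc_cnj_of_real: "sc_cnj (of_real c :: 'a::real_or_complex) = of_real c"
proof (cases "c = 0")
  case True
  have "sc_cnj (0 :: 'a) = 0"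
    using sc_cnj_add[of "0 :: 'a" 0] by simp
  then show ?thesis using True by simp
next
  case False
  have "of_real c * sc_cnj (of_real c :: 'a) = of_real c * of_real c"
    unfolding sc_mult_cnj by (simp add: scaleR_conv_of_real power2_eq_square)
  then show ?thesis using False by simp
qed

lemma norm_sc_cnj: "norm (sc_cnj x) = norm (x :: 'a::real_or_complex)"
proof (cases "x = 0")
  case True
  then show ?thesis using sc_cnj_of_real[of 0, where 'a = 'a] by simp
next
  case False
  have "norm x * norm (sc_cnj x) = norm x * norm x"
    unfolding norm_mult[symmetric] sc_mult_cnj by (simp add: power2_eq_square norm_mult)
  then show ?thesis using False by simp
qed

text \<open>Linearity is over the reals, whose elements conjugation fixes; in finite dimension it
  also yields continuity.\<close>

lemma linear_sc_cnj: "linear (sc_cnj :: 'a::real_or_complex \<Rightarrow> 'a)"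
  by (rule linearI) (simp_all add: sc_cnj_add scaleR_conv_of_real sc_cnj_mult sc_cnj_of_real)

lemma sc_Re_eqI: "x + sc_cnj x = (2 * t) *\<^sub>R (1 :: 'a::real_or_complex) \<Longrightarrow> sc_Re x = t"
  unfolding sc_add_cnj by simp

lemma linear_sc_Re: "linear (sc_Re :: 'a::real_or_complex \<Rightarrow> real)"
proof (rule linearI)
  fix x y :: 'a and c :: real
  have "x + y + sc_cnj (x + y) = (x + sc_cnj x) + (y + sc_cnj y)"
    by (simp add: sc_cnj_add)
  then show "sc_Re (x + y) = sc_Re x + sc_Re y"
    by (intro sc_Re_eqI) (simp only: sc_add_cnj scaleR_add_left[symmetric] distrib_left)
  have "c *\<^sub>R x + sc_cnj (c *\<^sub>R x) = c *\<^sub>R (x + sc_cnj x)"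
    by (simp add: linear_scale[OF linear_sc_cnj] scaleR_add_right)
  then show "sc_Re (c *\<^sub>R x) = c *\<^sub>R sc_Re x"
    by (intro sc_Re_eqI) (simp add: sc_add_cnj)
qed

lemma sc_Re_of_real: "sc_Re (t *\<^sub>R 1 :: 'a::real_or_complex) = t"
  by (rule sc_Re_eqI)
    (metis scaleR_left_distrib mult_2 of_real_def sc_cnj_of_real)

text \<open>Triangle inequality for \<open>x + sc_cnj x\<close>, whose two summands have equal
  norm.\<close>

lemma abs_sc_Re_le_norm: "\<bar>sc_Re x\<bar> \<le> norm (x :: 'a::real_or_complex)"
proof -
  have "2 * \<bar>sc_Re x\<bar> = norm (x + sc_cnj x)"
    unfolding sc_add_cnj by (simp add: abs_mult)
  also have "\<dots> \<le> 2 * norm x"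
    using norm_triangle_ineq[of x "sc_cnj x"] by (simp add: norm_sc_cnj)
  finally show ?thesis by simp
qed

section \<open>The inner products and norms induced by \<open>R\<close>\<close>

lemma ip_self: "ip x x = (norm x)\<^sup>2 *\<^sub>R (1 :: 'a::real_or_complex)"
  by (simp add: ip_def sc_mult_cnj norm_vec_def L2_set_def sum_nonneg scaleR_sum_left)

lemma ip_scaleR: "ip (c *\<^sub>R x) (c *\<^sub>R y) = c\<^sup>2 *\<^sub>R ip x (y :: 'a::real_or_complex ^ 'n)"
  by (simp add: ip_def linear_scale[OF linear_sc_cnj] scaleR_sum_right power2_eq_square)

lemma linear_matrix_vector_mult:
  "linear ((*v) (A :: 'a::real_or_complex ^ 'n ^ 'm))"
proof (rule linearI)
  show "A *v (c *\<^sub>R x) = c *\<^sub>R (A *v x)" for c x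
    by (simp add: vec_eq_iff matrix_vector_mult_def scaleR_sum_right)
qed (rule matrix_vector_right_distrib)

lemma norm_U_power2:
  assumes "hermitian_pos_def R"
  shows "(norm_U R x)\<^sup>2 = sc_Re (ip_U R x x)"
proof -
  have "0 \<le> sc_Re (ip_U R x x)"
  proof (cases "x = 0")
    case True
    then show ?thesis by (simp add: ip_U_def ip_def linear_0[OF linear_sc_Re])
  next
    case False
    then show ?thesis using assms by (auto simp: hermitian_pos_def_def ip_U_def less_imp_le)
  qed
  then show ?thesis by (simp add: norm_U_def)
qed

lemma norm_U_pos: "hermitian_pos_def R \<Longrightarrow> x \<noteq> 0 \<Longrightarrow> 0 < norm_U R x"
  by (simp add: norm_U_def ip_U_def hermitian_pos_def_def)

lemma norm_U_nonneg: "hermitian_pos_def R \<Longrightarrow> 0 \<le> norm_U R x"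
  by (metis norm_U_def norm_U_power2 real_sqrt_ge_zero zero_le_power2)

lemma norm_U_scaleR: "norm_U R (c *\<^sub>R x) = \<bar>c\<bar> * norm_U R x"
  by (simp add: norm_U_def ip_U_def linear_scale[OF linear_matrix_vector_mult] ip_scaleR
      linear_scale[OF linear_sc_Re] real_sqrt_mult)

lemma continuous_on_norm_U: "continuous_on S (norm_U R)"
proof -
  have Rx: "continuous_on S ((*v) R)"
    by (intro linear_continuous_on linear_conv_bounded_linear[THEN iffD1] linear_matrix_vector_mult)
  have cnj: "continuous_on S (\<lambda>x. sc_cnj (x $ i))" for i
    by (rule linear_continuous_on_compose[OF _ linear_sc_cnj]) (intro continuous_intros)
  have "continuous_on S (\<lambda>x. ip_U R x x)"
    unfolding ip_U_def ip_def by (intro continuous_intros Rx cnj)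
  then have "continuous_on S (\<lambda>x. sc_Re (ip_U R x x))"
    by (rule linear_continuous_on_compose[OF _ linear_sc_Re])
  then show ?thesis
    unfolding norm_U_def by (intro continuous_intros)
qed

text \<open>A kernel vector of \<open>R\<close> has energy norm 0, so positivity leaves only 0; a
  square matrix with trivial kernel is invertible.\<close>

lemma hermitian_pos_def_inverse:
  assumes "hermitian_pos_def (R :: 'a::real_or_complex ^ 'n ^ 'n)"
  shows "R *v (matrix_inv R *v y) = y"
proof -
  have "R *v x = 0 \<Longrightarrow> x = 0" for x
    using norm_U_pos[OF assms, of x]
    by (auto simp: norm_U_def ip_U_def ip_def linear_0[OF linear_sc_Re])
  then have "invertible R"
    by (simp add: invertible_left_inverse matrix_left_invertible_ker)
  \<comment> \<open>\<open>matrix_inv\<close> is a choice operator, so its defining property becomes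
    available only through invertibility.\<close>
  then have "R ** matrix_inv R = mat 1"
    unfolding invertible_def matrix_inv_def by (rule someI2_ex) simp
  then show ?thesis
    by (simp add: matrix_vector_mul_assoc)
qed

text \<open>\<open>matrix_inv R *v y\<close> is the Riesz representative of \<open>y\<close>. Both
  numerators thereby become norms of one vector, measured by \<open>norm_U R\<close> or after
  applying \<Theta>.\<close>

lemma norm_dual_eq_norm_U:
  assumes "hermitian_pos_def R"
  shows "norm_dual R y = norm_U R (matrix_inv R *v y)"
  by (simp add: norm_dual_def ip_dual_def norm_U_def ip_U_def hermitian_pos_def_inverse[OF assms])

section \<open>The embedding property on the residual space\<close>

lemma subspace_embedding_norm_bounds:
  assumes R: "hermitian_pos_def R" and emb: "subspace_embedding R \<Theta> \<epsilon> V" and y: "y \<in> V"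
  shows "sqrt (1 - \<epsilon>) * norm_U R y \<le> norm (\<Theta> *v y)"
    and "norm (\<Theta> *v y) \<le> sqrt (1 + \<epsilon>) * norm_U R y"
proof -
  \<comment> \<open>On the diagonal \<open>x = y\<close> both inner products reduce, after taking
    real parts, to squared norms.\<close>
  have "\<bar>(norm_U R y)\<^sup>2 - (norm (\<Theta> *v y))\<^sup>2\<bar> = \<bar>sc_Re (ip_U R y y - sketched_ip_U \<Theta> y y)\<bar>"
    by (simp add: linear_diff[OF linear_sc_Re] norm_U_power2[OF R] sketched_ip_U_def ip_self
        sc_Re_of_real)
  also have "\<dots> \<le> norm (ip_U R y y - sketched_ip_U \<Theta> y y)"
    by (rule abs_sc_Re_le_norm)
  also have "\<dots> \<le> \<epsilon> * norm_U R y * norm_U R y"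
    using emb y by (auto simp: subspace_embedding_def)
  finally have b: "\<bar>(norm_U R y)\<^sup>2 - (norm (\<Theta> *v y))\<^sup>2\<bar> \<le> \<epsilon> * (norm_U R y)\<^sup>2"
    by (simp add: power2_eq_square)
  \<comment> \<open>With the norm moved under the root, both claims become comparisons of
    squares.\<close>
  have s: "sqrt c * norm_U R y = sqrt (c * (norm_U R y)\<^sup>2)" for c
    using norm_U_nonneg[OF R] by (simp add: real_sqrt_mult)
  show "sqrt (1 - \<epsilon>) * norm_U R y \<le> norm (\<Theta> *v y)"
    unfolding s using b by (intro real_le_lsqrt norm_ge_zero) (simp add: algebra_simps abs_le_iff)
  show "norm (\<Theta> *v y) \<le> sqrt (1 + \<epsilon>) * norm_U R y"
    unfolding s using b by (intro real_le_rsqrt) (simp add: algebra_simps abs_le_iff)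
qed

text \<open>The subspace property of \<open>W\<close> supplies the points at which residuals are
  evaluated; the span in \<open>residual_space\<close> absorbs the factor \<open>c\<close> or the
  difference.\<close>

lemma inverse_image_in_residual_space:
  assumes Au: "A *v u = b" and W: "vec.subspace W" and x: "x \<in> vec.span {u} + W"
  shows "matrix_inv R *v (A *v x) \<in> residual_space R A b W"
proof -
  let ?\<rho> = "\<lambda>w. matrix_inv R *v residual A b w"
  have base: "?\<rho> w \<in> residual_space R A b W" if "w \<in> W" for w
    unfolding residual_space_def using that by (blast intro: vec.span_base)
  obtain c w where w: "w \<in> W" and x_eq: "x = c *s u + w"
    using x by (auto simp: set_plus_def vec.span_singleton)
  show ?thesis
  proof (cases "c = 0")
    case True
    then have "matrix_inv R *v (A *v x) = ?\<rho> 0 - ?\<rho> w"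
      by (simp add: x_eq residual_def matrix_vector_mult_diff_distrib)
    moreover have "?\<rho> 0 - ?\<rho> w \<in> residual_space R A b W"
      using base[OF vec.subspace_0[OF W]] base[OF w]
      unfolding residual_space_def by (rule vec.span_diff)
    ultimately show ?thesis by simp
  next
    case False
    let ?w = "(- inverse c) *s w"
    have "A *v ?w = (- inverse c) *s (A *v w)"
      by (rule vector_scalar_commute)
    then have "c *s residual A b ?w = A *v x"
      using False
      by (simp add: vec_eq_iff x_eq residual_def Au[symmetric] matrix_vector_right_distrib
          vector_scalar_commute algebra_simps)
    then have "matrix_inv R *v (A *v x) = c *s ?\<rho> ?w"
      by (metis vector_scalar_commute)
    moreover have "c *s ?\<rho> ?w \<in> residual_space R A b W"
      using base[OF vec.subspace_scale[OF W w]]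
      unfolding residual_space_def by (rule vec.span_scale)
    ultimately show ?thesis by simp
  qed
qed

section \<open>Compactness of the sets of quotients\<close>

text \<open>Real scalars act through \<open>of_real\<close>, so a span over the field is a real
  subspace, to which the real results on closedness apply.\<close>

lemma subspace_vec_span: "subspace (vec.span (S :: ('a::real_or_complex ^ 'n) set))"
proof (rule subspaceI)
  fix x :: "'a ^ 'n" and c :: real
  assume "x \<in> vec.span S"
  moreover have "c *\<^sub>R x = of_real c *s x"
    unfolding vec_eq_iff by (simp add: of_real_def)
  ultimately show "c *\<^sub>R x \<in> vec.span S"
    by (simp add: vec.span_scale)
qed (auto intro: vec.span_zero vec.span_add)

lemma compact_image_scale_invariant:
  fixes q :: "'b::euclidean_space \<Rightarrow> 'c::topological_space"
  assumes V: "subspace V" and cont: "continuous_on (- {0}) q"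
    and inv: "\<And>c x. 0 < c \<Longrightarrow> q (c *\<^sub>R x) = q x"
  shows "compact (q ` (V - {0}))"
proof -
  \<comment> \<open>Radial projection to the unit sphere preserves \<open>q\<close>, and the sphere
    avoids the origin, where continuity is not assumed.\<close>
  have "q x \<in> q ` (V \<inter> sphere 0 1)" if "x \<in> V - {0}" for x
  proof (rule image_eqI)
    show "q x = q (inverse (norm x) *\<^sub>R x)"
      using that by (simp add: inv)
    show "inverse (norm x) *\<^sub>R x \<in> V \<inter> sphere 0 1"
      using that V by (simp add: subspace_scale)
  qed
  then have "q ` (V - {0}) = q ` (V \<inter> sphere 0 1)"
    by fastforce
  moreover have "compact (V \<inter> sphere 0 1)"
    by (intro closed_Int_compact closed_subspace V compact_sphere)
  moreover have "continuous_on (V \<inter> sphere 0 1) q"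
    by (rule continuous_on_subset[OF cont]) auto
  ultimately show ?thesis
    by (simp add: compact_continuous_image)
qed

lemma quotients_eq_image:
  "quotients N R A u W = (\<lambda>x. N (A *v x) / norm_U R x) ` (vec.span {u} + W - {0})"
  by (auto simp: quotients_def)

text \<open>Abstracting \<open>N\<close> to a continuous, positively homogeneous function covers
  both the dual norm and the sketched semi-norm.\<close>

lemma compact_quotients:
  assumes R: "hermitian_pos_def R" and W: "W = vec.span S"
    and cont: "continuous_on UNIV N" and hom: "\<And>c x. 0 < c \<Longrightarrow> N (c *\<^sub>R x) = c * N x"
  shows "compact (quotients N R A u W)"
  unfolding quotients_eq_image
proof (rule compact_image_scale_invariant)
  show "subspace (vec.span {u} + W)"
  proof -
    have "vec.span {u} + W = vec.span ({u} \<union> S)"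
      unfolding W vec.span_Un set_plus_def by blast
    then show ?thesis by (simp only: subspace_vec_span)
  qed
  have "continuous_on (- {0}) (\<lambda>x. A *v x)"
    by (intro linear_continuous_on linear_conv_bounded_linear[THEN iffD1] linear_matrix_vector_mult)
  then have "continuous_on (- {0}) (\<lambda>x. N (A *v x))"
    by (rule continuous_on_compose2[OF cont]) auto
  then show "continuous_on (- {0}) (\<lambda>x. N (A *v x) / norm_U R x)"
    by (intro continuous_intros continuous_on_norm_U) (use norm_U_pos[OF R] in fastforce)+
qed (simp add: linear_scale[OF linear_matrix_vector_mult] hom norm_U_scaleR)

text \<open>A nonempty compact set of reals has a least element, and this gives \<open>LEAST\<close>
  its intended meaning.\<close>

lemma minimum_compact:
  assumes "compact S" and "S \<noteq> {}"
  shows "minimum S \<in> S" and "x \<in> S \<Longrightarrow> minimum S \<le> x"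
proof -
  obtain m where m: "m \<in> S" "\<And>y. y \<in> S \<Longrightarrow> m \<le> y"
    using compact_attains_inf[OF assms] by blast
  then have "minimum S = m"
    unfolding minimum_def by (intro Least_equality)
  then show "minimum S \<in> S" and "x \<in> S \<Longrightarrow> minimum S \<le> x"
    using m by auto
qed

lemma maximum_compact:
  assumes "compact S" and "S \<noteq> {}"
  shows "maximum S \<in> S" and "x \<in> S \<Longrightarrow> x \<le> maximum S"
proof -
  obtain m where m: "m \<in> S" "\<And>y. y \<in> S \<Longrightarrow> y \<le> m"
    using compact_attains_sup[OF assms] by blast
  then have "maximum S = m"
    unfolding maximum_def by (intro Greatest_equality)
  then show "maximum S \<in> S" and "x \<in> S \<Longrightarrow> x \<le> maximum S"
    using m by auto
qed

text \<open>The lower bound compares at a minimizer of \<open>g\<close>, the upper one at a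
  minimizer of \<open>f\<close>. The lemma serves twice: for \<open>I\<close> the nonzero vectors of
  one sum space, and for \<open>I\<close> the family of subspaces.\<close>

lemma minimum_image_bounds:
  assumes f: "compact (f ` I)" and g: "compact (g ` I)" and I: "I \<noteq> {}" and c: "0 \<le> c"
    and bnd: "\<And>i. i \<in> I \<Longrightarrow> c * f i \<le> g i \<and> g i \<le> d * f i"
  shows "c * minimum (f ` I) \<le> minimum (g ` I) \<and> minimum (g ` I) \<le> d * minimum (f ` I)"
proof
  obtain i where i: "i \<in> I" "minimum (g ` I) = g i"
    using minimum_compact(1)[OF g] I by auto
  have "c * minimum (f ` I) \<le> c * f i"
    using minimum_compact(2)[OF f] i c by (intro mult_left_mono) auto
  then show "c * minimum (f ` I) \<le> minimum (g ` I)"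
    using bnd[OF i(1)] i(2) by linarith
  obtain j where j: "j \<in> I" "minimum (f ` I) = f j"
    using minimum_compact(1)[OF f] I by auto
  have "minimum (g ` I) \<le> g j"
    using minimum_compact(2)[OF g] j by auto
  then show "minimum (g ` I) \<le> d * minimum (f ` I)"
    using bnd[OF j(1)] j(2) by auto
qed

text \<open>Here the lower bound uses a maximizer of \<open>f\<close> and the upper one a maximizer
  of \<open>g\<close>, so the sign condition moves from \<open>c\<close> to
  \<open>d\<close>.\<close>

lemma maximum_image_bounds:
  assumes f: "compact (f ` I)" and g: "compact (g ` I)" and I: "I \<noteq> {}" and d: "0 \<le> d"
    and bnd: "\<And>i. i \<in> I \<Longrightarrow> c * f i \<le> g i \<and> g i \<le> d * f i"
  shows "c * maximum (f ` I) \<le> maximum (g ` I) \<and> maximum (g ` I) \<le> d * maximum (f ` I)"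
proof
  obtain i where i: "i \<in> I" "maximum (f ` I) = f i"
    using maximum_compact(1)[OF f] I by auto
  have "g i \<le> maximum (g ` I)"
    using maximum_compact(2)[OF g] i by auto
  then show "c * maximum (f ` I) \<le> maximum (g ` I)"
    using bnd[OF i(1)] i(2) by auto
  obtain j where j: "j \<in> I" "maximum (g ` I) = g j"
    using maximum_compact(1)[OF g] I by auto
  have "d * f j \<le> d * maximum (f ` I)"
    using maximum_compact(2)[OF f] j d by (intro mult_left_mono) auto
  then show "maximum (g ` I) \<le> d * maximum (f ` I)"
    using bnd[OF j(1)] j(2) by linarith
qed

theorem proposition4p5:
  fixes R A :: "'a::real_or_complex ^ 'n ^ 'n"
    and \<Theta> :: "'a ^ 'n ^ 'k"
    and b u :: "'a ^ 'n"
    and D :: "('a ^ 'n) set"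
    and K r :: nat
    and \<epsilon> :: real
  assumes "CARD('k) \<le> CARD('n)"
    and "hermitian_pos_def R"
    and "A *v u = b"
    and "finite D" and "card D = K" and "1 \<le> r" and "r \<le> K"
    and "\<And>W. W \<in> spanned_subspaces r D \<Longrightarrow> vec.span {u} + W \<noteq> {0}"
    and "0 \<le> \<epsilon>" and "\<epsilon> \<le> 1"
    and "\<And>W. W \<in> spanned_subspaces r D \<Longrightarrow> subspace_embedding R \<Theta> \<epsilon> (residual_space R A b W)"
  shows "sqrt (1 - \<epsilon>) * zeta R A u r D \<le> sketched_zeta \<Theta> R A u r D
       \<and> sketched_zeta \<Theta> R A u r D \<le> sqrt (1 + \<epsilon>) * zeta R A u r D
       \<and> sqrt (1 - \<epsilon>) * iota R A u r D \<le> sketched_iota \<Theta> R A u r D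
       \<and> sketched_iota \<Theta> R A u r D \<le> sqrt (1 + \<epsilon>) * iota R A u r D"
proof -
  let ?I = "spanned_subspaces r D"
  let ?N = "norm_dual R" and ?M = "sketched_norm_dual \<Theta> R"
  note R = \<open>hermitian_pos_def R\<close>
  \<comment> \<open>A finite dictionary spans finitely many subspaces, so the outer extrema run over
    finite, hence compact, sets.\<close>
  have "?I \<subseteq> vec.span ` Pow D"
    by (auto simp: spanned_subspaces_def)
  then have fin: "finite ?I"
    using \<open>finite D\<close> by (meson finite_Pow_iff finite_imageI finite_subset)
  obtain S where "S \<subseteq> D" "card S = r"
    using obtain_subset_with_card_n[of r D] \<open>card D = K\<close> \<open>r \<le> K\<close> by auto
  then have ne: "?I \<noteq> {}"
    by (auto simp: spanned_subspaces_def)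
  have lin: "linear ((*v) (matrix_inv R))" "linear ((*v) \<Theta>)"
    by (rule linear_matrix_vector_mult)+
  then have cont_inv: "continuous_on UNIV ((*v) (matrix_inv R))"
    by (intro linear_continuous_on linear_conv_bounded_linear[THEN iffD1])
  have contN: "continuous_on UNIV ?N"
    unfolding norm_dual_eq_norm_U[OF R, abs_def]
    by (rule continuous_on_compose2[OF continuous_on_norm_U cont_inv]) auto
  have contM: "continuous_on UNIV ?M"
    unfolding sketched_norm_dual_def[abs_def]
    by (intro continuous_on_norm linear_continuous_on_compose[OF _ lin(2)] cont_inv)
  have W: "compact (quotients ?N R A u W) \<and> compact (quotients ?M R A u W)
      \<and> vec.span {u} + W - {0} \<noteq> {}
      \<and> (\<forall>x \<in> vec.span {u} + W - {0}.
          sqrt (1 - \<epsilon>) * (?N (A *v x) / norm_U R x) \<le> ?M (A *v x) / norm_U R x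
        \<and> ?M (A *v x) / norm_U R x \<le> sqrt (1 + \<epsilon>) * (?N (A *v x) / norm_U R x))"
    if W: "W \<in> ?I" for W
  proof (intro conjI ballI)
    obtain S where S: "W = vec.span S"
      using W by (auto simp: spanned_subspaces_def)
    show "compact (quotients ?N R A u W)"
      by (rule compact_quotients[OF R S contN])
        (simp add: norm_dual_eq_norm_U[OF R] linear_scale[OF lin(1)] norm_U_scaleR)
    show "compact (quotients ?M R A u W)"
      by (rule compact_quotients[OF R S contM])
        (simp add: sketched_norm_dual_def linear_scale[OF lin(1)] linear_scale[OF lin(2)])
    \<comment> \<open>The sum contains 0, so differing from \<open>{0}\<close> forces a nonzero
      element.\<close>
    have "0 + 0 \<in> vec.span {u} + W"
      unfolding S by (intro set_plus_intro vec.span_zero)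
    then show "vec.span {u} + W - {0} \<noteq> {}"
      using assms(8)[OF W] by auto
    fix x assume x: "x \<in> vec.span {u} + W - {0}"
    have "matrix_inv R *v (A *v x) \<in> residual_space R A b W"
      using inverse_image_in_residual_space[OF \<open>A *v u = b\<close>, of W x R] x
      by (simp add: S)
    note bounds = subspace_embedding_norm_bounds[OF R assms(11)[OF W] this]
    have "0 < norm_U R x"
      using norm_U_pos[OF R] x by auto
    then show "sqrt (1 - \<epsilon>) * (?N (A *v x) / norm_U R x) \<le> ?M (A *v x) / norm_U R x"
      and "?M (A *v x) / norm_U R x \<le> sqrt (1 + \<epsilon>) * (?N (A *v x) / norm_U R x)"
      using bounds
      by (simp_all add: norm_dual_eq_norm_U[OF R] sketched_norm_dual_def divide_right_mono)
  qed
  have sqrts: "0 \<le> sqrt (1 - \<epsilon>)" "0 \<le> sqrt (1 + \<epsilon>)"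
    using \<open>0 \<le> \<epsilon>\<close> \<open>\<epsilon> \<le> 1\<close> by auto
  \<comment> \<open>First level: the pointwise bounds on the quotients pass to the extrema over one
    sum space.\<close>
  have inner:
    "sqrt (1 - \<epsilon>) * minimum (quotients ?N R A u W) \<le> minimum (quotients ?M R A u W)
      \<and> minimum (quotients ?M R A u W) \<le> sqrt (1 + \<epsilon>) * minimum (quotients ?N R A u W)"
    "sqrt (1 - \<epsilon>) * maximum (quotients ?N R A u W) \<le> maximum (quotients ?M R A u W)
      \<and> maximum (quotients ?M R A u W) \<le> sqrt (1 + \<epsilon>) * maximum (quotients ?N R A u W)"
    if "W \<in> ?I" for W
    using W[OF that] sqrts unfolding quotients_eq_image
    by (intro minimum_image_bounds maximum_image_bounds; blast)+
  have comp: "compact (h ` ?I)" for h :: "_ \<Rightarrow> real"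
    using fin by (intro finite_imp_compact finite_imageI)
  show ?thesis
    unfolding zeta_def iota_def sketched_zeta_def sketched_iota_def Setcompr_eq_image
    \<comment> \<open>Second level: the inner bounds now play the role of the pointwise ones, over
      the family of subspaces.\<close>
    using minimum_image_bounds[OF comp comp ne sqrts(1) inner(1)]
      maximum_image_bounds[OF comp comp ne sqrts(2) inner(2)]
    by simp
qed

end
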